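(* Let $X\subset\mathbb R\times\mathbb R^d$, let $L:\mathbb R\times\mathbb R^d\times\mathbb R^d\to(-\infty,+\infty]$ be a Lagrangian and let $S_{\mathrm{traj}}\subset C^0(\mathbb R,\mathbb R^d)$ be a set of absolutely continuous trajectories. If $L(\cdot)\ge0$, then the Maupertuis kernel $b_{\mathrm{Maup}}$ is a tropical positive semidefinite (tpsd) kernel on $X$.
   Context: Points of $X$ are written $x=(t,r)$ with $t\in\mathbb R$, $r\in\mathbb R^d$. The Maupertuis kernel is defined, for $x_0=(t_0,r_0)$ and $x_1=(t_1,r_1)$ in $X$, by $$b_{\mathrm{Maup}}(x_0,x_1)=-\inf\Big\{\operatorname{sign}(t_1-t_0)\int_{t_0}^{t_1}L(s,r(s),\dot r(s))\,ds\ :\ r(\cdot)\in S_{\mathrm{traj}},\ r(t_0)=r_0,\ r(t_1)=r_1\Big\},$$ i.e. minus the infimum, over the trajectories in $S_{\mathrm{traj}}$ passing through both points, of the integral of $L$ over the interval $[\min(t_0,t_1),\max(t_0,t_1)]$ (equal to $0$ if $t_0=t_1$), with the convention $\inf\emptyset=+\infty$. $L$ is assumed measurable so that the integrals make sense (with values in $[0,+\infty]$ when $L\ge0$). Trajectories are absolutely continuous on bounded intervals. A kernel $b:X\times X\to[-\infty,+\infty)$ is tpsd if $b(x,y)=b(y,x)$ and $b(x,x)+b(y,y)\ge b(x,y)+b(y,x)$ for all $x,y\in X$ (with $-\infty$ absorbing). *)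

theory Defs
  imports "HOL-Analysis.Analysis"
begin

text \<open>Tropical positive semidefiniteness of a kernel with values in \<open>[-\<infinity>, +\<infinity>)\<close>. The codomain
  restriction makes \<open>-\<infinity>\<close> absorbing in the sums below: in \<^typ>\<open>ereal\<close>, \<open>-\<infinity> + a = -\<infinity>\<close> for
  \<open>a \<noteq> \<infinity>\<close>.\<close>

definition tpsd_on :: "'x set \<Rightarrow> ('x \<Rightarrow> 'x \<Rightarrow> ereal) \<Rightarrow> bool" where
  "tpsd_on X b \<longleftrightarrow>
     (\<forall>x\<in>X. \<forall>y\<in>X. b x y < \<infinity>) \<and>
     (\<forall>x\<in>X. \<forall>y\<in>X. b x y = b y x) \<and>
     (\<forall>x\<in>X. \<forall>y\<in>X. b x x + b y y \<ge> b x y + b y x)"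

text \<open>Classical absolute continuity of a curve on \<open>[a, b]\<close>. A finite family \<open>d\<close> with
  \<open>d division_of \<Union>d\<close> is a finite family of nonempty compact intervals with pairwise disjoint
  interiors; an interval \<open>K\<close> has endpoints \<open>Inf K\<close> and \<open>Sup K\<close>. (The library constant
  \<^const>\<open>absolutely_continuous\<close> is about measures.)\<close>

definition abs_continuous_on_interval :: "real \<Rightarrow> real \<Rightarrow> (real \<Rightarrow> 'v::real_normed_vector) \<Rightarrow> bool"
  where
  "abs_continuous_on_interval a b r \<longleftrightarrow>
     (\<forall>\<epsilon>>0. \<exists>\<delta>>0. \<forall>d. d division_of \<Union>d \<and> \<Union>d \<subseteq> {a..b} \<and> (\<Sum>K\<in>d. Sup K - Inf K) < \<delta>
        \<longrightarrow> (\<Sum>K\<in>d. norm (r (Sup K) - r (Inf K))) < \<epsilon>)"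

definition abs_continuous_curve :: "(real \<Rightarrow> 'v::real_normed_vector) \<Rightarrow> bool" where
  "abs_continuous_curve r \<longleftrightarrow> (\<forall>a b. abs_continuous_on_interval a b r)"

text \<open>Lebesgue integral of an extended-real function as positive part minus negative part;
  \<^const>\<open>e2ennreal\<close> sends negative values to \<open>0\<close>. If both parts have infinite integral the value is
  \<open>\<infinity> - \<infinity> = \<infinity>\<close> by the convention of \<^typ>\<open>ereal\<close>.\<close>

definition ext_integral :: "'a measure \<Rightarrow> ('a \<Rightarrow> ereal) \<Rightarrow> ereal" where
  "ext_integral M f =
     enn2ereal (\<integral>\<^sup>+ s. e2ennreal (f s) \<partial>M) - enn2ereal (\<integral>\<^sup>+ s. e2ennreal (- f s) \<partial>M)"

definition oriented_integral :: "real \<Rightarrow> real \<Rightarrow> (real \<Rightarrow> ereal) \<Rightarrow> ereal" where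
  "oriented_integral a b f =
     (if a \<le> b then ext_integral (lebesgue_on {a..b}) f
      else - ext_integral (lebesgue_on {b..a}) f)"

text \<open>The velocity is the \<^const>\<open>vector_derivative\<close>, whose value is unspecified where the trajectory
  is not differentiable; for absolutely continuous trajectories this is a null set. The infimum of
  the empty set is \<open>\<infinity>\<close> in \<^typ>\<open>ereal\<close>.\<close>

definition maupertuis_kernel ::
  "(real \<times> (real^'n) \<times> (real^'n) \<Rightarrow> ereal) \<Rightarrow> (real \<Rightarrow> real^'n) set
    \<Rightarrow> real \<times> (real^'n) \<Rightarrow> real \<times> (real^'n) \<Rightarrow> ereal" where
  "maupertuis_kernel L S = (\<lambda>(t0, r0) (t1, r1).
     - Inf {ereal (sgn (t1 - t0))
              * oriented_integral t0 t1 (\<lambda>s. L (s, r s, vector_derivative r (at s))) | r.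
            r \<in> S \<and> r t0 = r0 \<and> r t1 = r1})"

end

theory Submission
  imports Defs
begin

text \<open>
  Two facts about the Maupertuis kernel \<open>b\<close> carry the proof. The sign factor cancels the
  orientation of the integral, so the action of a trajectory between two times is the
  unoriented integral of \<open>L\<close> over the time interval that they span; hence \<open>b\<close> is symmetric
  and, since \<open>L \<ge> 0\<close>, nowhere positive. On the diagonal the action vanishes, so \<open>b x x\<close> only
  records whether some trajectory passes through \<open>x\<close>: it is \<open>0\<close> if one does and \<open>-\<infinity>\<close> (an
  infimum over the empty set) if none does.

  If \<open>x\<close> and \<open>y\<close> each lie on some trajectory, possibly on different ones, then
  \<open>b x x + b y y = 0 \<ge> b x y + b y x\<close>. Otherwise no trajectory joins \<open>x\<close> and \<open>y\<close>, so
  \<open>b x y = b y x = -\<infinity>\<close> and the smaller side of the inequality is \<open>-\<infinity>\<close>.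
\<close>

lemma ext_integral_nonneg:
  assumes "\<And>s. f s \<ge> 0"
  shows "ext_integral M f \<ge> 0"
proof -
  \<comment> \<open>The negative part has integral \<open>0\<close>, so the difference is the integral of the positive part.\<close>
  have "(\<integral>\<^sup>+ s. e2ennreal (- f s) \<partial>M) = 0"
    using assms by (simp add: e2ennreal_neg)
  then show ?thesis
    by (simp add: ext_integral_def zero_ennreal.rep_eq)
qed

text \<open>For \<open>b < a\<close> the factor \<open>-1\<close> undoes the sign in the oriented integral; for \<open>a = b\<close> the
  factor \<open>0\<close> annihilates even an infinite value.\<close>

lemma sgn_times_oriented_integral:
  "ereal (sgn (b - a)) * oriented_integral a b f =
     (if a = b then 0 else ext_integral (lebesgue_on {min a b..max a b}) f)"
  by (auto simp: oriented_integral_def min_def max_def one_ereal_def[symmetric]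
      simp flip: uminus_ereal.simps(1))

lemma maupertuis_kernel_commute: "maupertuis_kernel L S x y = maupertuis_kernel L S y x"
proof -
  obtain t0 r0 t1 r1 where "x = (t0, r0)" "y = (t1, r1)"
    by fastforce
  then show ?thesis
    by (simp add: maupertuis_kernel_def sgn_times_oriented_integral min.commute max.commute
        eq_commute[of t0 t1] conj_commute[of "_ t0 = r0"])
qed

lemma maupertuis_kernel_nonpos:
  assumes "\<And>p. L p \<ge> 0"
  shows "maupertuis_kernel L S x y \<le> 0"
proof -
  obtain t0 r0 t1 r1 where "x = (t0, r0)" "y = (t1, r1)"
    by fastforce
  then show ?thesis
    using assms
    by (auto simp: maupertuis_kernel_def sgn_times_oriented_integral ext_integral_nonneg
        intro!: Inf_greatest)
qed

lemma maupertuis_kernel_unreachable: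
  assumes "\<not> (\<exists>r\<in>S. r t0 = r0)"
  shows "maupertuis_kernel L S (t0, r0) y = -\<infinity>"
proof -
  obtain t1 r1 where y: "y = (t1, r1)"
    by fastforce
  have empty: "{ereal (sgn (t1 - t0)) * oriented_integral t0 t1 (\<lambda>s. L (s, r s, vector_derivative r (at s)))
      | r. r \<in> S \<and> r t0 = r0 \<and> r t1 = r1} = {}"
    using assms by blast
  show ?thesis
    unfolding maupertuis_kernel_def y prod.case empty by (simp add: top_ereal_def)
qed

lemma maupertuis_kernel_diagonal:
  "maupertuis_kernel L S (t, q) (t, q) = (if \<exists>r\<in>S. r t = q then 0 else -\<infinity>)"
proof (cases "\<exists>r\<in>S. r t = q")
  case True
  then have "{ereal (sgn (t - t)) * oriented_integral t t (\<lambda>s. L (s, r s, vector_derivative r (at s)))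
      | r. r \<in> S \<and> r t = q \<and> r t = q} = {0}"
    by auto
  with True show ?thesis
    by (simp add: maupertuis_kernel_def)
next
  case False
  then show ?thesis
    by (simp add: maupertuis_kernel_unreachable)
qed

theorem lemma7p4:
  fixes X :: "(real \<times> (real^'n)) set"
    and L :: "real \<times> (real^'n) \<times> (real^'n) \<Rightarrow> ereal"
    and S :: "(real \<Rightarrow> real^'n) set"
  assumes L_range: "\<And>p. L p > -\<infinity>"
    and L_meas: "L \<in> borel_measurable borel"
    and S_cont: "\<And>r. r \<in> S \<Longrightarrow> continuous_on UNIV r"
    and S_ac: "\<And>r. r \<in> S \<Longrightarrow> abs_continuous_curve r"
    and L_nonneg: "\<And>p. L p \<ge> 0"
  shows "tpsd_on X (maupertuis_kernel L S)"
proof -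
  let ?b = "maupertuis_kernel L S"
  have nonpos: "?b x y \<le> 0" for x y
    using L_nonneg by (rule maupertuis_kernel_nonpos)
  have "?b x y + ?b y x \<le> ?b x x + ?b y y" for x y
  proof (cases "?b x x = 0 \<and> ?b y y = 0")
    case True
    then show ?thesis
      using add_mono[OF nonpos[of x y] nonpos[of y x]] by simp
  next
    case False
    then have "?b x y = -\<infinity>"
      using maupertuis_kernel_unreachable[of S "fst x" "snd x" L y]
        maupertuis_kernel_unreachable[of S "fst y" "snd y" L x]
        maupertuis_kernel_diagonal[of L S "fst x" "snd x"]
        maupertuis_kernel_diagonal[of L S "fst y" "snd y"]
        maupertuis_kernel_commute[of L S x y]
      by (auto split: if_splits)
    then show ?thesis
      using maupertuis_kernel_commute[of L S x y] by simp
  qed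
  moreover have "?b x y < \<infinity>" for x y
    using nonpos[of x y] by (rule order_le_less_trans) simp
  ultimately show ?thesis
    using maupertuis_kernel_commute[of L S] by (auto simp: tpsd_on_def)
qed

end
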